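(* Let $G$ be a plane weighted graph with $2n+1$ vertices. Let distinct vertices $a_1, b_1, a_2, b_2, \ldots, a_k, b_k$, where $2 \leq k \leq n$, appear in this cyclic order on a face of $G$, and let $A=\{a_1,\ldots,a_k\}$ and $B=\{b_1,\ldots,b_k\}$. Then for every partition of $A$ into disjoint subsets $A_1, A_2$, we have \[ \sum_{W\subseteq B,\ |W| \text{ odd}} M(G-W)\,M(G-A-\overline{W}) = \sum_{Y\subseteq B,\ |Y|-|A_1| \text{ odd}} M(G-A_1-Y)\,M(G-A_2-\overline{Y}), \] where $\overline{W}=B\setminus W$ and $\overline{Y}=B\setminus Y$; the first sum is over subsets $W\subseteq B$ of odd cardinality, the second over subsets $Y\subseteq B$ whose cardinality has parity opposite to that of $|A_1|$.
   Context: For a weighted graph $G$, the weight of a perfect matching is the product of the weights of its edges, and $M(G)$ denotes the sum of the weights of all perfect matchings of $G$ ($0$ if there are none). For a set $S$ of vertices, $G-S$ denotes the subgraph of $G$ induced by the vertices not in $S$; $G-A-W$ means $G-(A\cup W)$. *)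

theory Defs
  imports "HOL-Analysis.Analysis"
begin

text \<open>
  A weighted graph drawn in the plane \<open>complex\<close>: vertices are points, and an edge is the point set
  of an arc, so that the endpoints of an edge \<open>e\<close> are the elements of \<open>e \<inter> verts G\<close>.
\<close>

record 'w plane_wgraph =
  verts :: "complex set"
  edges :: "complex set set"
  weight :: "complex set \<Rightarrow> 'w"

text \<open>
  Edges join two distinct vertices, contain no further vertex, and meet other edges only in
  vertices. Parallel edges are allowed, and \<open>G\<close> need not be connected.
\<close>

definition plane_graph :: "'w plane_wgraph \<Rightarrow> bool" where
  "plane_graph G \<longleftrightarrow>
     finite (verts G) \<and> finite (edges G) \<and>
     (\<forall>e\<in>edges G. \<exists>g. arc g \<and> path_image g = e \<and> e \<inter> verts G = {pathstart g, pathfinish g}) \<and>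
     (\<forall>e\<in>edges G. \<forall>f\<in>edges G. e \<noteq> f \<longrightarrow> e \<inter> f \<subseteq> verts G)"

definition faces :: "'w plane_wgraph \<Rightarrow> complex set set" where
  "faces G = components (- (verts G \<union> \<Union>(edges G)))"

text \<open>
  The points \<open>vs\<close> occur in this cyclic order on the boundary of the face \<open>F\<close>: some Jordan curve,
  one of whose two sides is contained in \<open>F\<close>, runs through them in this order. If \<open>F\<close> is bounded by
  a cycle of the graph, the curve can be that cycle (\<open>F\<close> being its inside, or its outside when \<open>F\<close>
  is the unbounded face). In general the boundary walk of \<open>F\<close> may repeat vertices or be
  disconnected; the curve may then run through the interior of \<open>F\<close> between consecutive points of
  \<open>vs\<close>. Neither the direction of traversal nor the starting point is prescribed.
\<close>

definition cyclic_order_on_face :: "complex set \<Rightarrow> complex list \<Rightarrow> bool" where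
  "cyclic_order_on_face F vs \<longleftrightarrow>
     (\<exists>g. simple_path g \<and> pathfinish g = pathstart g \<and>
          (inside (path_image g) \<subseteq> F \<or> outside (path_image g) \<subseteq> F) \<and>
          (\<exists>ts. sorted_wrt (<) ts \<and> set ts \<subseteq> {0..<1} \<and> map g ts = vs))"

definition delete_verts :: "'w plane_wgraph \<Rightarrow> complex set \<Rightarrow> 'w plane_wgraph" (infixl "\<ominus>" 65) where
  "G \<ominus> S = G\<lparr>verts := verts G - S, edges := {e \<in> edges G. e \<inter> verts G \<inter> S = {}}\<rparr>"

definition perfect_matchings :: "'w plane_wgraph \<Rightarrow> complex set set set" where
  "perfect_matchings G = {m. m \<subseteq> edges G \<and> (\<forall>v\<in>verts G. \<exists>!e. e \<in> m \<and> v \<in> e)}"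

definition M :: "'w::comm_ring_1 plane_wgraph \<Rightarrow> 'w" where
  "M G = (\<Sum>m\<in>perfect_matchings G. \<Prod>e\<in>m. weight G e)"

end

theory Submission imports Defs begin

text \<open>
  Superimpose the two matchings of a term. Every vertex outside \<open>A \<union> B\<close> is covered by both
  matchings and every terminal in \<open>A \<union> B\<close> by exactly one, so the components of the superposition
  are cycles, doubled edges and paths joining the terminals in pairs. By planarity the paths do not
  cross, so there is an even number of terminals between the two ends of a path; as the \<open>a\<^sub>i\<close> and
  \<open>b\<^sub>i\<close> alternate, no path joins two elements of \<open>A\<close>. Exchanging the two matchings on the components
  meeting \<open>A1\<close> is therefore a weight-preserving involution between the pairs counted on the two
  sides. The parity conditions only discard terms that vanish because \<open>G\<close> has an odd number of vertices.
\<close>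

subsection \<open>Disjoint continua attached to a Jordan curve\<close>

lemma simple_path_eqD:
  assumes "simple_path g" "g x = g y" "x \<in> {0..1}" "y \<in> {0..1}"
  shows "x = y \<or> x = 0 \<and> y = 1 \<or> x = 1 \<and> y = 0"
  using assms unfolding simple_path_def loop_free_def by blast

text \<open>Collects what the arguments use about a side of the curve, so that the bounded and the
  unbounded side are treated together.\<close>

lemma Jordan_side:
  fixes g :: "real \<Rightarrow> complex"
  assumes "simple_path g" "pathfinish g = pathstart g"
    and "I = inside (path_image g) \<or> I = outside (path_image g)"
  shows "open I" "connected I" "I \<noteq> {}" "frontier I = path_image g" "I \<inter> path_image g = {}"
  using Jordan_inside_outside [OF assms(1,2)] assms(3) inside_no_overlap outside_no_overlap by metis+

text \<open>The chord \<open>c\<close> and the arc from \<open>g s\<close> to \<open>g t\<close>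
  form a Jordan curve \<open>h\<close>. The rest of \<open>g\<close> lies on one side of
  \<open>h\<close>; the other side lies in \<open>I\<close> and accumulates at \<open>g r\<close>.
  Near \<open>y\<close>, points of \<open>I\<close> lie on the first side.\<close>

lemma chord_separates_Jordan_side:
  fixes g c :: "real \<Rightarrow> complex"
  assumes g: "simple_path g" "pathfinish g = pathstart g"
    and I: "I = inside (path_image g) \<or> I = outside (path_image g)"
    and c: "arc c" "pathstart c = g s" "pathfinish c = g t" "c ` {0<..<1} \<subseteq> I"
    and str: "0 < s" "s < r" "r < t" "t < 1"
    and y: "y \<in> g ` ({0..<s} \<union> {t<..1})"
    and UV: "open U" "g r \<in> U" "open V" "y \<in> V"
  obtains u v where "u \<in> U \<inter> I" "v \<in> V \<inter> I"
    "\<not> connected_component (- (g ` {s..t} \<union> path_image c)) u v"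
proof -
  note I' = Jordan_side [OF g I]
  have cont: "continuous_on {0..1} g"
    using g(1) simple_path_imp_path path_def by blast
  have inj: "x = y" if "g x = g y" "x \<in> {0<..<1}" "y \<in> {0..1}" for x y
    using simple_path_eqD [OF g(1) that(1)] that by auto
  have cimg: "path_image c \<subseteq> I \<union> {g s, g t}"
  proof -
    have "{0..1::real} = {0<..<1} \<union> {0,1}" by auto
    then have "path_image c = c ` {0<..<1} \<union> {c 0, c 1}"
      by (metis path_image_def image_Un image_insert image_empty)
    then show ?thesis using c by (auto simp: pathstart_def pathfinish_def)
  qed
  \<comment> \<open>Runs backwards, from \<open>g t\<close> to \<open>g s\<close>, so that
    \<open>c\<close> followed by \<open>d\<close> closes up.\<close>
  define d where "d = subpath t s g"
  define h where "h = c +++ d"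
  have dimg: "path_image d = g ` {s..t}"
    using str by (simp add: d_def path_image_subpath)
  have dends: "pathstart d = g t" "pathfinish d = g s"
    by (simp_all add: d_def)
  have d: "arc d"
    unfolding d_def
  proof (rule arc_simple_path_subpath)
    show "g t \<noteq> g s" using inj [of t s] str by auto
  qed (use g str in auto)
  have gim: "g ` {s..t} \<subseteq> path_image g"
    using str by (auto simp: path_image_def)
  have hsp: "simple_path h"
    unfolding h_def
  proof (rule simple_path_join_loop)
    show "path_image c \<inter> path_image d \<subseteq> {pathstart c, pathstart d}"
    proof -
      have "path_image c \<inter> g ` {s..t} \<subseteq> {g s, g t}"
        using cimg gim I' by blast
      then show ?thesis using c dimg dends by simp
    qed
  qed (use c d dends in auto)
  have hloop: "pathfinish h = pathstart h"
    using c dends by (simp add: h_def)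
  have himg: "path_image h = g ` {s..t} \<union> path_image c"
    unfolding h_def using c dends dimg by (simp add: path_image_join Un_commute)
  define R where "R = g ` ({0..<s} \<union> {t<..1})"
  have R_disj: "R \<inter> path_image h = {}"
  proof -
    have "g x \<noteq> g z" if "x \<in> {0..<s} \<union> {t<..1}" "z \<in> {s..t}" for x z
      using inj [of z x] that str by force
    then have "R \<inter> g ` {s..t} = {}"
      unfolding R_def by blast
    moreover have "R \<inter> I = {}"
      using I' str by (auto simp: R_def path_image_def)
    moreover have "g s \<in> g ` {s..t}" "g t \<in> g ` {s..t}"
      using str by auto
    ultimately show ?thesis
      using cimg unfolding himg by blast
  qed
  \<comment> \<open>The two pieces of the complementary arc share the base point
    \<open>g 0 = g 1\<close>.\<close>
  have "connected (g ` {0..<s} \<union> g ` {t<..1})"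
  proof (rule connected_Un)
    show "connected (g ` {0..<s})" "connected (g ` {t<..1})"
      using str by (auto intro!: connected_continuous_image continuous_on_subset [OF cont])
    have "g 0 = g 1" using g by (simp add: pathstart_def pathfinish_def)
    then show "g ` {0..<s} \<inter> g ` {t<..1} \<noteq> {}"
      using str by (metis atLeastLessThan_iff disjoint_iff greaterThanAtMost_iff imageI order_refl)
  qed
  then have Rconn: "connected R" by (simp add: R_def image_Un)
  have "y \<in> R" using y by (simp add: R_def)
  \<comment> \<open>\<open>X\<close> is the side of \<open>h\<close> chosen to contain
    \<open>R\<close>.\<close>
  obtain X Y where XY: "open X" "open Y" "connected X" "connected Y" "X \<inter> Y = {}"
    "X \<union> Y = - path_image h" "frontier X = path_image h" "frontier Y = path_image h"
    "R \<subseteq> X"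
  proof -
    obtain i j where ij: "open i" "connected i" "open j" "connected j" "i \<inter> j = {}"
      "i \<union> j = - path_image h" "frontier i = path_image h" "frontier j = path_image h"
      by (rule Jordan_curve [OF hsp hloop])
    have "R \<subseteq> i \<union> j" using R_disj ij by auto
    then have "R \<subseteq> i \<or> R \<subseteq> j"
      using connectedD [OF Rconn \<open>open i\<close> \<open>open j\<close>] ij \<open>y \<in> R\<close> by blast
    then show ?thesis
    proof
      assume "R \<subseteq> i" then show ?thesis using that [of i j] ij by auto
    next
      assume "R \<subseteq> j" then show ?thesis using that [of j i] ij by auto
    qed
  qed
  have gsplit: "path_image g = g ` {s..t} \<union> R"
  proof -
    have "{0..1} = {s..t} \<union> ({0..<s} \<union> {t<..1})" using str by auto
    then show ?thesis unfolding path_image_def R_def by (metis image_Un)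
  qed
  \<comment> \<open>The side of \<open>h\<close> not containing \<open>R\<close> misses \<open>g\<close> and reaches the chord, hence lies in \<open>I\<close>.\<close>
  have "Y \<subseteq> I"
  proof -
    have "Y \<inter> path_image g = {}"
      using XY himg unfolding gsplit by blast
    moreover have "Y \<inter> I \<noteq> {}"
    proof -
      have "c (1/2) \<in> I" using c by auto
      moreover have "c (1/2) \<in> frontier Y"
        unfolding XY himg by (auto simp: path_image_def)
      then have "c (1/2) \<in> closure Y" by (simp add: frontier_def)
      ultimately show ?thesis
        using \<open>open I\<close> open_Int_closure_eq_empty by blast
    qed
    ultimately show ?thesis
      using connected_Int_frontier [OF \<open>connected Y\<close>] I' by blast
  qed
  have "g r \<in> frontier Y" unfolding XY himg using str by auto
  then have "U \<inter> Y \<noteq> {}"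
    using UV open_Int_closure_eq_empty [of U Y] by (auto simp: frontier_def)
  then obtain u where u: "u \<in> U" "u \<in> Y" by auto
  \<comment> \<open>\<open>y\<close> lies in the open set \<open>X\<close> and on the frontier of
    \<open>I\<close>, so \<open>I\<close> reaches into \<open>V \<inter> X\<close>.\<close>
  have "y \<in> frontier I"
    using \<open>y \<in> R\<close> I' gsplit by auto
  then have "(V \<inter> X) \<inter> I \<noteq> {}"
    using UV XY \<open>y \<in> R\<close> open_Int_closure_eq_empty [of "V \<inter> X" I] open_Int [of V X] by (auto simp: frontier_def)
  then obtain v where v: "v \<in> V" "v \<in> X" "v \<in> I" by auto
  have "\<not> connected_component (- path_image h) u v"
  proof
    assume "connected_component (- path_image h) u v"
    then obtain T where "connected T" "T \<subseteq> X \<union> Y" "u \<in> T" "v \<in> T"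
      using XY by (auto simp: connected_component_def)
    then show False
      using connectedD [OF \<open>connected T\<close> \<open>open X\<close> \<open>open Y\<close>] u v XY by auto
  qed
  then show ?thesis
    using that u v \<open>Y \<subseteq> I\<close> by (auto simp: himg)
qed

text \<open>The rest of the curve is compact, hence closed. Density of accessible points is
  available for relatively open parts of the frontier, such as these open subarcs.\<close>

lemma openin_simple_path_image:
  fixes g :: "real \<Rightarrow> complex"
  assumes g: "simple_path g" and "0 < s" "s \<le> t" "t < 1"
  shows "openin (top_of_set (path_image g)) (g ` {s<..<t})"
proof -
  have cont: "continuous_on {0..1} g"
    using g simple_path_imp_path path_def by blast
  have "compact (g ` {0..s} \<union> g ` {t..1})"
    using assms by (intro compact_Un compact_continuous_image continuous_on_subset [OF cont]) auto
  then have cl: "closed (g ` {0..s} \<union> g ` {t..1})" by (rule compact_imp_closed)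
  have "g x \<noteq> g y" if "x \<in> {s<..<t}" "y \<in> {0..s} \<union> {t..1}" for x y
    using simple_path_eqD [OF g, of x y] that assms by fastforce
  then have "g ` {s<..<t} \<inter> (g ` {0..s} \<union> g ` {t..1}) = {}" by blast
  moreover have "path_image g = g ` {s<..<t} \<union> (g ` {0..s} \<union> g ` {t..1})"
  proof -
    have "{0..1} = {s<..<t} \<union> ({0..s} \<union> {t..1})" using assms by auto
    then show ?thesis unfolding path_image_def by (metis image_Un)
  qed
  ultimately have "g ` {s<..<t} = path_image g \<inter> - (g ` {0..s} \<union> g ` {t..1})" by blast
  then show ?thesis using cl by (metis openin_open open_Compl)
qed

text \<open>By continuity of \<open>g\<close> at \<open>t\<close>. It lets a continuum be extended
  along the curve without touching \<open>Q\<close>.\<close>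

lemma short_subpath_avoids_compact:
  fixes g :: "real \<Rightarrow> complex"
  assumes "path g" "compact Q" "g t \<notin> Q" "0 \<le> t" "t < t'" "t' \<le> 1"
  obtains s where "t < s" "s < t'" "g ` {t..s} \<inter> Q = {}"
proof -
  have cont: "continuous (at t within {0..1}) g"
    using assms by (simp add: path_def continuous_on_eq_continuous_within)
  have "open (- Q)" using assms compact_imp_closed by blast
  then have "\<forall>\<^sub>F x in at t within {0..1}. g x \<in> - Q"
    using cont assms by (auto simp: continuous_within tendsto_def)
  then obtain d where d: "d > 0" "\<And>x. x \<in> {0..1} \<Longrightarrow> x \<noteq> t \<Longrightarrow> dist x t < d \<Longrightarrow> g x \<notin> Q"
    unfolding eventually_at by auto
  define s where "s = min (t + d/2) ((t+t')/2)"
  have st: "t < s" "s < t'" "s - t < d" using d assms by (auto simp: s_def min_def)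
  have "g x \<notin> Q" if "x \<in> {t..s}" for x
    using d(2)[of x] assms st that by (cases "x = t") (auto simp: dist_real_def)
  then show ?thesis using that st by blast
qed

text \<open>A chord \<open>c\<close> inside \<open>I\<close> joins points of the curve near \<open>g t1\<close> and \<open>g t3\<close>, and \<open>P'\<close> is \<open>P\<close> extended
  along the curve to the ends of \<open>c\<close>. With \<open>J\<^sub>1\<close> the arc of the curve between these ends, \<open>J\<^sub>1 \<union> c\<close>
  separates points of \<open>I\<close> near \<open>g t2\<close> and \<open>g t4\<close>, while \<open>J\<^sub>1 \<union> P'\<close> does not. As \<open>P'\<close> is connected,
  Janiszewski's theorem shows that already \<open>c \<union> P'\<close> separates them; but \<open>Q\<close> avoids \<open>c \<union> P'\<close>.
  Chords exist only between accessible points, which are dense; hence the passage to \<open>P'\<close>.\<close>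

lemma no_interlaced_continua:
  fixes g :: "real \<Rightarrow> complex"
  assumes g: "simple_path g" "pathfinish g = pathstart g"
    and I: "I = inside (path_image g) \<or> I = outside (path_image g)"
    and t: "0 \<le> t1" "t1 < t2" "t2 < t3" "t3 < t4" "t4 < 1"
    and P: "compact P" "connected P" "P \<inter> I = {}" "g t1 \<in> P" "g t3 \<in> P"
    and Q: "compact Q" "connected Q" "Q \<inter> I = {}" "g t2 \<in> Q" "g t4 \<in> Q"
    and PQ: "P \<inter> Q = {}"
  shows False
proof -
  note I' = Jordan_side [OF g I]
  have pg: "path g" using g(1) simple_path_imp_path by blast
  then have cont: "continuous_on {0..1} g" by (simp add: path_def)
  have inj: "x = y" if "g x = g y" "x \<in> {0<..<1}" "y \<in> {0..1}" for x y
    using simple_path_eqD [OF g(1) that(1)] that by auto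
  obtain e1 where e1: "t1 < e1" "e1 < t2" "g ` {t1..e1} \<inter> Q = {}"
    by (rule short_subpath_avoids_compact [OF pg \<open>compact Q\<close>, of t1 t2]) (use t P PQ in auto)
  obtain e3 where e3: "t3 < e3" "e3 < t4" "g ` {t3..e3} \<inter> Q = {}"
    by (rule short_subpath_avoids_compact [OF pg \<open>compact Q\<close>, of t3 t4]) (use t P PQ in auto)
  \<comment> \<open>\<open>t1\<close> may be 0, the base point of the loop, where injectivity fails;
    starting at \<open>m\<close> keeps the parameters positive.\<close>
  define m where "m = (t1 + e1) / 2"
  have m: "t1 < m" "m < e1" using e1 by (auto simp: m_def)
  \<comment> \<open>The theorem on pairs of accessible frontier points asks for two different open
    sets.\<close>
  have ne: "g ` {m<..<e1} \<noteq> g ` {t3<..<e3}"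
  proof
    assume eq: "g ` {m<..<e1} = g ` {t3<..<e3}"
    have "g ((m+e1)/2) \<in> g ` {t3<..<e3}" unfolding eq [symmetric] using m by auto
    then obtain x where x: "g ((m+e1)/2) = g x" "x \<in> {t3<..<e3}" by auto
    have "(m+e1)/2 = x"
      by (rule inj [OF x(1)]) (use x m e1 e3 t in auto)
    then show False using x m e1 e3 t by auto
  qed
  obtain c where c: "arc c" "pathstart c \<in> g ` {m<..<e1}" "pathfinish c \<in> g ` {t3<..<e3}"
    "c ` {0<..<1} \<subseteq> I"
  proof (rule dense_accessible_frontier_point_pairs [OF I'(1,2) _ _ _ _ ne])
    show "openin (top_of_set (frontier I)) (g ` {m<..<e1})"
      unfolding I'(4) by (rule openin_simple_path_image [OF g(1)]) (use m e1 t in auto)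
    show "openin (top_of_set (frontier I)) (g ` {t3<..<e3})"
      unfolding I'(4) by (rule openin_simple_path_image [OF g(1)]) (use e3 t in auto)
  qed (use m e3 in auto)
  obtain s where s: "pathstart c = g s" "m < s" "s < e1" using c(2) by auto
  obtain r where r: "pathfinish c = g r" "t3 < r" "r < e3" using c(3) by auto
  define P' where "P' = P \<union> g ` {t1..e1} \<union> g ` {t3..e3}"
  have P'c: "compact P'"
    unfolding P'_def using t e1 e3 P
    by (intro compact_Un compact_continuous_image continuous_on_subset [OF cont]) auto
  have P'n: "connected P'"
  proof -
    have "connected (g ` {t1..e1})" "connected (g ` {t3..e3})"
      using t e1 e3 by (auto intro!: connected_continuous_image continuous_on_subset [OF cont])
    moreover have "g t1 \<in> P \<inter> g ` {t1..e1}" "g t3 \<in> (P \<union> g ` {t1..e1}) \<inter> g ` {t3..e3}"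
      using P e1 e3 by auto
    ultimately show ?thesis
      unfolding P'_def using P by (metis connected_Un empty_iff)
  qed
  have gI: "g x \<notin> I" if "x \<in> {0..1}" for x
    using I' that by (auto simp: path_image_def)
  have P'I: "P' \<inter> I = {}"
    using P gI e1 e3 t by (auto simp: P'_def)
  have P'Q: "P' \<inter> Q = {}"
    using PQ e1 e3 by (auto simp: P'_def)
  have sP: "g s \<in> P'" "g r \<in> P'"
    using s r m by (auto simp: P'_def)
  have cimg: "path_image c \<subseteq> I \<union> {g s, g r}"
  proof -
    have "{0..1::real} = {0<..<1} \<union> {0,1}" by auto
    then have "path_image c = c ` {0<..<1} \<union> {c 0, c 1}"
      by (metis path_image_def image_Un image_insert image_empty)
    then show ?thesis using c s r by (auto simp: pathstart_def pathfinish_def)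
  qed
  define K where "K = path_image c \<union> P'"
  have Kc: "closed K"
    unfolding K_def using P'c c(1) by (simp add: closed_Un closed_arc_image compact_imp_closed)
  \<comment> \<open>\<open>Q\<close> avoids \<open>I\<close>, where the interior of \<open>c\<close>
    runs, and the ends of \<open>c\<close> belong to \<open>P'\<close>.\<close>
  have QK: "Q \<subseteq> - K"
    using P'Q cimg Q(3) sP unfolding K_def by blast
  obtain d where d: "d > 0" "ball (g t2) d \<subseteq> - K"
    using Kc QK Q(4) open_contains_ball [of "- K"] by blast
  obtain d' where d': "d' > 0" "ball (g t4) d' \<subseteq> - K"
    using Kc QK Q(5) open_contains_ball [of "- K"] by blast
  obtain u v where uv: "u \<in> ball (g t2) d \<inter> I" "v \<in> ball (g t4) d' \<inter> I"
    "\<not> connected_component (- (g ` {s..r} \<union> path_image c)) u v"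
  proof (rule chord_separates_Jordan_side [OF g I c(1) s(1) r(1) c(4),
        where r = t2 and y = "g t4" and U = "ball (g t2) d" and V = "ball (g t4) d'"])
    show "g t4 \<in> g ` ({0..<s} \<union> {r<..1})" using e3 r t by auto
    show "open (ball (g t2) d)" "open (ball (g t4) d')" by auto
  qed (use s r t e1 e3 m d d' in auto)
  \<comment> \<open>The discs, chosen clear of \<open>K\<close>, attach \<open>u\<close> and
    \<open>v\<close> to \<open>Q\<close>.\<close>
  have "connected (ball (g t2) d \<union> Q \<union> ball (g t4) d')"
  proof -
    have "g t2 \<in> ball (g t2) d \<inter> Q" "g t4 \<in> (ball (g t2) d \<union> Q) \<inter> ball (g t4) d'"
      using Q d d' by auto
    then show ?thesis using Q(2) by (metis connected_Un connected_ball empty_iff)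
  qed
  then have 1: "connected_component (- K) u v"
    unfolding connected_component_def using uv d d' QK by blast
  define J where "J = g ` {s..r} \<union> P'"
  have Jc: "compact J"
    unfolding J_def using P'c s r t m e3
    by (intro compact_Un compact_continuous_image continuous_on_subset [OF cont]) auto
  have JI: "J \<inter> I = {}"
    using P'I gI s r t m e3 by (auto simp: J_def)
  \<comment> \<open>\<open>I\<close> itself is a connected set off \<open>J\<close> containing
    \<open>u\<close> and \<open>v\<close>.\<close>
  have 2: "connected_component (- J) u v"
    unfolding connected_component_def using JI I' uv by blast
  have gsub: "g ` {s..r} \<subseteq> - I" using gI s r t m e3 by auto
  have "g ` {s..r} \<inter> path_image c \<subseteq> {g s, g r}"
    using gsub cimg by fastforce
  then have "g ` {s..r} \<inter> path_image c \<subseteq> P'"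
    using sP by auto
  then have "J \<inter> K = P'"
    unfolding J_def K_def by auto
  then have 3: "connected_component (- (J \<union> K)) u v"
    using Janiszewski [OF Jc Kc _ 2 1] P'n by simp
  have "connected_component (- (g ` {s..r} \<union> path_image c)) u v"
    by (rule connected_component_of_subset [OF 3]) (auto simp: J_def K_def)
  with uv show False by blast
qed

subsection \<open>Perfect matchings of plane graphs\<close>

lemma plane_graph_finite:
  assumes "plane_graph G"
  shows "finite (verts G)" "finite (edges G)"
  using assms by (auto simp: plane_graph_def)

lemma plane_graph_edge:
  assumes "plane_graph G" "e \<in> edges G"
  shows "card (e \<inter> verts G) = 2" "compact e" "connected e"
proof -
  obtain g where g: "arc g" "path_image g = e" "e \<inter> verts G = {pathstart g, pathfinish g}"
    using assms by (auto simp: plane_graph_def)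
  show "card (e \<inter> verts G) = 2"
    using g arc_distinct_ends [OF g(1)] by simp
  show "compact e" "connected e"
    using g compact_arc_image [OF g(1)] connected_arc_image [OF g(1)] by simp_all
qed

lemma plane_graph_edges_meet:
  assumes "plane_graph G" "e \<in> edges G" "f \<in> edges G" "e \<noteq> f"
  shows "e \<inter> f \<subseteq> verts G"
  using assms by (auto simp: plane_graph_def)

lemma perfect_matchings_delete_verts:
  "m \<in> perfect_matchings (G \<ominus> S) \<longleftrightarrow>
     m \<subseteq> edges G \<and> (\<forall>e\<in>m. e \<inter> verts G \<inter> S = {}) \<and> (\<forall>v\<in>verts G - S. \<exists>!e. e \<in> m \<and> v \<in> e)"
  by (auto simp: perfect_matchings_def delete_verts_def)

lemma perfect_matching_deleteD:
  assumes "m \<in> perfect_matchings (G \<ominus> S)"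
  shows "m \<subseteq> edges G"
    and "e \<in> m \<Longrightarrow> v \<in> e \<Longrightarrow> v \<in> verts G \<Longrightarrow> v \<notin> S"
    and "v \<in> verts G \<Longrightarrow> v \<notin> S \<Longrightarrow> \<exists>e\<in>m. v \<in> e"
proof -
  note pm = assms [unfolded perfect_matchings_delete_verts]
  show "m \<subseteq> edges G" using pm by (rule conjunct1)
  show "v \<notin> S" if "e \<in> m" "v \<in> e" "v \<in> verts G"
  proof -
    have "e \<inter> verts G \<inter> S = {}" using pm that(1) by simp
    then show ?thesis using that by blast
  qed
  show "\<exists>e\<in>m. v \<in> e" if "v \<in> verts G" "v \<notin> S"
  proof -
    have "\<exists>!e. e \<in> m \<and> v \<in> e" using pm that by simp
    then show ?thesis by blast
  qed
qed

lemma perfect_matching_edge_unique: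
  assumes "m \<in> perfect_matchings (G \<ominus> S)" "v \<in> verts G" "e \<in> m" "f \<in> m" "v \<in> e" "v \<in> f"
  shows "e = f"
proof -
  have "v \<notin> S" using assms perfect_matching_deleteD(2) by blast
  then have "\<exists>!e. e \<in> m \<and> v \<in> e"
    using assms by (simp add: perfect_matchings_delete_verts)
  then show ?thesis using assms by blast
qed

lemma finite_perfect_matchings:
  assumes "plane_graph G"
  shows "finite (perfect_matchings (G \<ominus> S))"
  by (rule finite_subset [of _ "Pow (edges G)"])
     (use plane_graph_finite [OF assms] perfect_matching_deleteD(1) in auto)

lemma M_delete_verts:
  "M (G \<ominus> S) = (\<Sum>m\<in>perfect_matchings (G \<ominus> S). prod (weight G) m)"
  by (simp add: M_def delete_verts_def)

text \<open>For a set \<open>H\<close> of edges, these are the vertex sets of unions of components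
  of the subgraph with edge set \<open>H\<close>.\<close>

definition edge_closed :: "'w plane_wgraph \<Rightarrow> complex set set \<Rightarrow> complex set \<Rightarrow> bool" where
  "edge_closed G H C \<longleftrightarrow> C \<subseteq> verts G \<and> (\<forall>e\<in>H. e \<inter> verts G \<subseteq> C \<or> e \<inter> verts G \<inter> C = {})"

lemma edge_closed_mono: "edge_closed G H C \<Longrightarrow> H' \<subseteq> H \<Longrightarrow> edge_closed G H' C"
  by (auto simp: edge_closed_def)

text \<open>The end pairs of the matching edges that meet \<open>C\<close> partition
  \<open>C - S\<close>.\<close>

lemma even_card_edge_closed:
  assumes "plane_graph G" and m: "m \<in> perfect_matchings (G \<ominus> S)" and C: "edge_closed G m C"
  shows "even (card (C - S))"
proof -
  define D where "D = {e \<in> m. e \<inter> verts G \<inter> C \<noteq> {}}"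
  note pm = perfect_matching_deleteD [OF m]
  have D: "D \<subseteq> edges G"
    using pm(1) by (auto simp: D_def)
  then have finD: "finite D"
    using plane_graph_finite [OF assms(1)] finite_subset by blast
  have un: "C - S = (\<Union>e\<in>D. e \<inter> verts G)"
  proof (intro subset_antisym subsetI)
    fix v assume v: "v \<in> C - S"
    then have "v \<in> verts G" using C by (auto simp: edge_closed_def)
    with v obtain e where "e \<in> m" "v \<in> e" using pm(3) [of v] by auto
    then show "v \<in> (\<Union>e\<in>D. e \<inter> verts G)"
      using v \<open>v \<in> verts G\<close> by (auto simp: D_def)
  next
    fix v assume "v \<in> (\<Union>e\<in>D. e \<inter> verts G)"
    then obtain e where e: "e \<in> m" "e \<inter> verts G \<inter> C \<noteq> {}" "v \<in> e" "v \<in> verts G"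
      by (auto simp: D_def)
    then have "e \<inter> verts G \<subseteq> C" using C by (auto simp: edge_closed_def)
    then show "v \<in> C - S" using e pm(2) by blast
  qed
  have "card (C - S) = (\<Sum>e\<in>D. card (e \<inter> verts G))"
    unfolding un
  proof (rule card_UN_disjoint)
    show "\<forall>e\<in>D. \<forall>f\<in>D. e \<noteq> f \<longrightarrow> e \<inter> verts G \<inter> (f \<inter> verts G) = {}"
      using perfect_matching_edge_unique [OF m] unfolding D_def by blast
  qed (use finD plane_graph_finite [OF assms(1)] in auto)
  also have "\<dots> = 2 * card D"
    using plane_graph_edge(1) [OF assms(1)] D by (simp add: subset_iff)
  finally show ?thesis by simp
qed

lemma M_eq_0_if_odd:
  assumes "plane_graph G" "odd (card (verts G - S))"
  shows "M (G \<ominus> S) = 0"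
proof -
  have "perfect_matchings (G \<ominus> S) = {}"
    using even_card_edge_closed [OF assms(1), of _ S "verts G"] assms(2)
    by (auto simp: edge_closed_def)
  then show ?thesis by (simp add: M_def)
qed

section \<open>Exchanging two matchings on a union of components\<close>

definition exchange :: "complex set \<Rightarrow> complex set set \<Rightarrow> complex set set \<Rightarrow> complex set set" where
  "exchange C m m' = {e \<in> m. e \<inter> C = {}} \<union> {e \<in> m'. e \<inter> C \<noteq> {}}"

lemma exchange_Un: "exchange C m m' \<union> exchange C m' m = m \<union> m'"
  by (auto simp: exchange_def)

lemma exchange_exchange: "exchange C (exchange C m m') (exchange C m' m) = m"
  by (auto simp: exchange_def)

lemma prod_exchange:
  fixes w :: "complex set \<Rightarrow> 'w::comm_ring_1"
  assumes "finite m" "finite m'"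
  shows "prod w (exchange C m m') * prod w (exchange C m' m) = prod w m * prod w m'"
proof -
  have split: "prod w m1 = prod w {e \<in> m1. e \<inter> C = {}} * prod w {e \<in> m1. e \<inter> C \<noteq> {}}"
    if "finite m1" for m1
    using that by (subst prod.union_disjoint [symmetric]) (auto intro!: prod.cong)
  have ex: "prod w (exchange C m1 m2) = prod w {e \<in> m1. e \<inter> C = {}} * prod w {e \<in> m2. e \<inter> C \<noteq> {}}"
    if "finite m1" "finite m2" for m1 m2
    unfolding exchange_def using that by (subst prod.union_disjoint) auto
  show ?thesis
    using split [of m] split [of m'] ex [of m m'] ex [of m' m] assms by (simp add: ac_simps)
qed

text \<open>No edge of \<open>m \<union> m'\<close> leaves \<open>C\<close>, so after the exchange a
  vertex in \<open>C\<close> sees only edges of \<open>m'\<close> and any other vertex only edges of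
  \<open>m\<close>. The deleted set follows the same rule.\<close>

lemma exchange_perfect_matching:
  assumes m: "m \<in> perfect_matchings (G \<ominus> S)" and m': "m' \<in> perfect_matchings (G \<ominus> S')"
    and C: "edge_closed G (m \<union> m') C"
  shows "exchange C m m' \<in> perfect_matchings (G \<ominus> (S - C \<union> S' \<inter> C))"
proof -
  have CV: "C \<subseteq> verts G" using C by (simp add: edge_closed_def)
  have cl: "e \<inter> C = {} \<or> e \<inter> verts G \<subseteq> C" if "e \<in> m \<union> m'" for e
    using C that CV unfolding edge_closed_def by blast
  note pm = m [unfolded perfect_matchings_delete_verts] m' [unfolded perfect_matchings_delete_verts]
  have "\<exists>!e. e \<in> exchange C m m' \<and> v \<in> e"
    if v: "v \<in> verts G" "v \<notin> S - C \<union> S' \<inter> C" for v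
  proof (cases "v \<in> C")
    case True
    then have "\<And>e. e \<in> exchange C m m' \<and> v \<in> e \<longleftrightarrow> e \<in> m' \<and> v \<in> e"
      by (auto simp: exchange_def)
    then show ?thesis using pm v True by auto
  next
    case False
    then have "\<And>e. e \<in> exchange C m m' \<and> v \<in> e \<longleftrightarrow> e \<in> m \<and> v \<in> e"
      using cl v(1) unfolding exchange_def by blast
    then show ?thesis using pm v False by auto
  qed
  moreover have "e \<inter> verts G \<inter> (S - C \<union> S' \<inter> C) = {}" if e: "e \<in> exchange C m m'" for e
  proof (cases "e \<inter> C = {}")
    case True
    then have "e \<in> m" using e by (auto simp: exchange_def)
    then show ?thesis using True perfect_matching_deleteD(2) [OF m] by blast
  next
    case False
    then have "e \<in> m'" using e by (auto simp: exchange_def)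
    then show ?thesis using False cl [of e] perfect_matching_deleteD(2) [OF m'] by blast
  qed
  moreover have "exchange C m m' \<subseteq> edges G"
    using pm by (auto simp: exchange_def)
  ultimately show ?thesis
    by (auto simp: perfect_matchings_delete_verts)
qed

subsection \<open>Components of a superposition\<close>

definition adj :: "'w plane_wgraph \<Rightarrow> complex set set \<Rightarrow> complex rel" where
  "adj G H = {(u, v). \<exists>e\<in>H. u \<in> e \<inter> verts G \<and> v \<in> e \<inter> verts G}"

lemma adj_rtrancl_sym: "(u, v) \<in> (adj G H)\<^sup>* \<Longrightarrow> (v, u) \<in> (adj G H)\<^sup>*"
  by (rule symD [OF sym_rtrancl]) (auto simp: adj_def sym_def)

lemma edge_closed_adj_image:
  assumes "X \<subseteq> verts G"
  shows "edge_closed G H ((adj G H)\<^sup>* `` X)"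
proof -
  have "v \<in> verts G" if "(u, v) \<in> (adj G H)\<^sup>*" "u \<in> X" for u v
    using that by (induction rule: rtrancl_induct) (use assms in \<open>auto simp: adj_def\<close>)
  moreover have "v \<in> (adj G H)\<^sup>* `` X"
    if "e \<in> H" "u \<in> e \<inter> verts G" "v \<in> e \<inter> verts G" "u \<in> (adj G H)\<^sup>* `` X" for e u v
  proof -
    have "(u, v) \<in> adj G H" using that by (auto simp: adj_def)
    then show ?thesis using that by (auto intro: rtrancl_into_rtrancl)
  qed
  ultimately show ?thesis unfolding edge_closed_def by blast
qed

lemma adj_image_minimal:
  assumes "edge_closed G H C" "X \<subseteq> C"
  shows "(adj G H)\<^sup>* `` X \<subseteq> C"
proof -
  have "v \<in> C" if "(u, v) \<in> (adj G H)\<^sup>*" "u \<in> X" for u v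
    using that
  proof (induction rule: rtrancl_induct)
    case base
    then show ?case using assms by auto
  next
    case (step y z)
    then show ?case using assms(1) unfolding edge_closed_def adj_def by fast
  qed
  then show ?thesis by auto
qed

text \<open>A vertex set containing \<open>a\<close> that is left by at most one edge is grown along that edge until
  it meets a second terminal or swallows the component.\<close>

lemma component_at_most_two_leaves:
  assumes fin: "finite (verts G)" and card2: "\<And>e. e \<in> H \<Longrightarrow> card (e \<inter> verts G) = 2"
    and leaf: "\<And>v e f. v \<in> T \<Longrightarrow> v \<in> verts G \<Longrightarrow> e \<in> H \<Longrightarrow> f \<in> H \<Longrightarrow> v \<in> e \<Longrightarrow> v \<in> f \<Longrightarrow> e = f"
    and deg2: "\<And>v e f h. v \<in> verts G \<Longrightarrow> e \<in> H \<Longrightarrow> f \<in> H \<Longrightarrow> h \<in> H \<Longrightarrow>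
                 v \<in> e \<Longrightarrow> v \<in> f \<Longrightarrow> v \<in> h \<Longrightarrow> e = f \<or> e = h \<or> f = h"
    and a: "a \<in> T" "a \<in> verts G"
    and p: "p \<in> T" "(a, p) \<in> (adj G H)\<^sup>*" "p \<noteq> a"
    and q: "q \<in> T" "(a, q) \<in> (adj G H)\<^sup>*" "q \<noteq> a"
  shows "p = q"
proof -
  define leaving where "leaving U = {e \<in> H. e \<inter> U \<noteq> {} \<and> \<not> e \<inter> verts G \<subseteq> U}" for U
  define \<U> where "\<U> = {U. U \<subseteq> verts G \<and> a \<in> U \<and> U \<inter> T \<subseteq> {a} \<and>
    (\<forall>e\<in>leaving U. \<forall>f\<in>leaving U. e = f)}"
  have reach: "(adj G H)\<^sup>* `` {a} \<subseteq> U" if "leaving U = {}" "U \<subseteq> verts G" "a \<in> U" for U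
    by (rule adj_image_minimal) (use that in \<open>auto simp: edge_closed_def leaving_def\<close>)
  have "\<U> \<subseteq> Pow (verts G)" by (auto simp: \<U>_def)
  then have "finite \<U>" using fin by (simp add: finite_subset)
  moreover have "{a} \<in> \<U>"
    using a leaf [of a] by (auto simp: \<U>_def leaving_def)
  \<comment> \<open>Maximality replaces growing step by step: an admissible set that can still grow
    contradicts it.\<close>
  ultimately obtain U where U: "U \<in> \<U>" and max: "\<And>U'. U' \<in> \<U> \<Longrightarrow> U \<subseteq> U' \<Longrightarrow> U = U'"
    using finite_has_maximal2 [of \<U> "{a}"] by blast
  then have U': "U \<subseteq> verts G" "a \<in> U" "U \<inter> T \<subseteq> {a}"
    "\<And>e f. e \<in> leaving U \<Longrightarrow> f \<in> leaving U \<Longrightarrow> e = f"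
    by (auto simp: \<U>_def)
  have "leaving U \<noteq> {}"
  proof
    assume "leaving U = {}"
    then have "p \<in> U" using reach [of U] U'(1,2) p(2) by auto
    then show False using U'(3) p by auto
  qed
  then obtain e where e: "e \<in> leaving U" by blast
  then obtain u v where uv: "u \<in> e" "u \<in> U" "v \<in> e" "v \<in> verts G" "v \<notin> U" and eH: "e \<in> H"
    unfolding leaving_def by blast
  have "u \<in> verts G" using uv U' by auto
  obtain x y where "e \<inter> verts G = {x, y}"
    using card2 [OF eH] by (meson card_2_iff)
  then have ev: "e \<inter> verts G \<subseteq> insert v U"
  proof -
    have "u \<in> {x, y}" "v \<in> {x, y}" "u \<noteq> v"
      using uv \<open>u \<in> verts G\<close> by (auto simp flip: \<open>e \<inter> verts G = {x, y}\<close>)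
    then show ?thesis using uv \<open>e \<inter> verts G = {x, y}\<close> by auto
  qed
  have at_v: "v \<in> f" "f \<noteq> e" "f \<in> H" if "f \<in> leaving (insert v U)" for f
  proof -
    show "f \<in> H" "f \<noteq> e" using that ev by (auto simp: leaving_def)
    show "v \<in> f"
    proof (rule ccontr)
      assume "v \<notin> f"
      then have "f \<in> leaving U" using that unfolding leaving_def by blast
      then show False using U'(4) e \<open>f \<noteq> e\<close> by blast
    qed
  qed
  \<comment> \<open>Otherwise \<open>v\<close> carries at most one edge besides \<open>e\<close>,
    and \<open>insert v U\<close> would be a larger member of \<open>\<U>\<close>.\<close>
  have "v \<in> T"
  proof (rule ccontr)
    assume "v \<notin> T"
    have "f = g" if "f \<in> leaving (insert v U)" "g \<in> leaving (insert v U)" for f g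
      using deg2 [of v e f g] at_v [OF that(1)] at_v [OF that(2)] uv eH by auto
    then have "insert v U \<in> \<U>"
      using U' uv \<open>v \<notin> T\<close> by (auto simp: \<U>_def)
    then show False using max [of "insert v U"] uv by blast
  qed
  \<comment> \<open>As a terminal, \<open>v\<close> carries only \<open>e\<close>, whose ends now
    both lie in the set. So the component lies in \<open>insert v U\<close>, and \<open>p\<close>
    and \<open>q\<close> can only be \<open>v\<close>.\<close>
  then have "leaving (insert v U) = {}"
    using leaf [of v e] at_v uv eH by blast
  then have "(adj G H)\<^sup>* `` {a} \<subseteq> insert v U"
    by (rule reach) (use U' uv in auto)
  then have "p \<in> insert v U" "q \<in> insert v U" using p q by auto
  moreover have "p \<notin> U" "q \<notin> U" using p q U'(3) by auto
  ultimately show ?thesis by simp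
qed

text \<open>The reachable vertices are included separately, since a vertex on no edge of
  \<open>H\<close> would otherwise be missing.\<close>

definition component_drawing :: "'w plane_wgraph \<Rightarrow> complex set set \<Rightarrow> complex \<Rightarrow> complex set" where
  "component_drawing G H v = (adj G H)\<^sup>* `` {v} \<union> \<Union>{e \<in> H. e \<inter> (adj G H)\<^sup>* `` {v} \<noteq> {}}"

lemma adj_image_subset_verts: "v \<in> verts G \<Longrightarrow> (adj G H)\<^sup>* `` {v} \<subseteq> verts G"
  using edge_closed_adj_image [of "{v}" G H] by (simp add: edge_closed_def)

lemma component_drawing_subset:
  assumes "H \<subseteq> edges G" "v \<in> verts G"
  shows "component_drawing G H v \<subseteq> verts G \<union> \<Union>(edges G)"
  unfolding component_drawing_def using assms(1)
  by (intro Un_mono adj_image_subset_verts [OF assms(2)] Union_mono) auto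

lemma compact_component_drawing:
  assumes G: "plane_graph G" and "H \<subseteq> edges G" "v \<in> verts G"
  shows "compact (component_drawing G H v)"
proof -
  have "finite ((adj G H)\<^sup>* `` {v})"
    using adj_image_subset_verts [OF assms(3)] plane_graph_finite [OF G] finite_subset by blast
  moreover have "compact (\<Union>{e \<in> H. e \<inter> (adj G H)\<^sup>* `` {v} \<noteq> {}})"
  proof (rule compact_Union)
    show "finite {e \<in> H. e \<inter> (adj G H)\<^sup>* `` {v} \<noteq> {}}"
      using assms(2) plane_graph_finite [OF G] finite_subset [of H] by auto
  qed (use assms(2) plane_graph_edge [OF G] in auto)
  ultimately show ?thesis
    unfolding component_drawing_def by (simp add: compact_Un finite_imp_compact)
qed

lemma connected_component_drawing:
  assumes G: "plane_graph G" and H: "H \<subseteq> edges G" and v: "v \<in> verts G"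
  shows "connected (component_drawing G H v)"
proof -
  let ?K = "component_drawing G H v"
  have edge: "connected_component ?K x y"
    if "e \<in> H" "c \<in> e" "(v, c) \<in> (adj G H)\<^sup>*" "x \<in> e" "y \<in> e" for e c x y
  proof -
    have "e \<subseteq> ?K" using that unfolding component_drawing_def by blast
    moreover have "connected e" using plane_graph_edge [OF G] H that by blast
    ultimately show ?thesis using that by (auto simp: connected_component_def)
  qed
  have reach: "connected_component ?K v u" if "(v, u) \<in> (adj G H)\<^sup>*" for u
    using that
  proof (induction rule: rtrancl_induct)
    case base
    then show ?case by (simp add: connected_component_refl component_drawing_def)
  next
    case (step y z)
    then obtain e where "e \<in> H" "y \<in> e" "z \<in> e" by (auto simp: adj_def)
    then have "connected_component ?K y z" using edge step.hyps(1) by blast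
    then show ?case using step.IH connected_component_trans by blast
  qed
  have "connected_component ?K v z" if z: "z \<in> ?K" for z
  proof (cases "(v, z) \<in> (adj G H)\<^sup>*")
    case False
    with z obtain e c where "e \<in> H" "z \<in> e" "c \<in> e" "(v, c) \<in> (adj G H)\<^sup>*"
      unfolding component_drawing_def by blast
    then show ?thesis using edge [of e c c z] reach [of c] connected_component_trans by blast
  qed (use reach in auto)
  then show ?thesis
    unfolding connected_iff_connected_component
    by (metis connected_component_sym connected_component_trans)
qed

text \<open>Closedness excludes a common vertex. A common point elsewhere would lie on an edge of
  each component; distinct edges meet only in vertices, so the two edges would coincide and join the
  components.\<close>

lemma component_drawings_disjoint:
  assumes G: "plane_graph G" and H: "H \<subseteq> edges G" and v: "v \<in> verts G" "w \<in> verts G"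
    and vw: "(v, w) \<notin> (adj G H)\<^sup>*"
  shows "component_drawing G H v \<inter> component_drawing G H w = {}"
proof -
  let ?C = "\<lambda>v. (adj G H)\<^sup>* `` {v}"
  have disj: "?C v \<inter> ?C w = {}"
  proof (rule equals0I)
    fix z assume "z \<in> ?C v \<inter> ?C w"
    then have "(v, z) \<in> (adj G H)\<^sup>*" "(z, w) \<in> (adj G H)\<^sup>*"
      by (auto intro: adj_rtrancl_sym)
    then show False using vw rtrancl_trans by metis
  qed
  have cl: "edge_closed G H (?C v)" "edge_closed G H (?C w)"
    using v by (auto intro!: edge_closed_adj_image)
  have inC: "z \<in> C" if "edge_closed G H C" "z \<in> e" "e \<in> H" "e \<inter> C \<noteq> {}" "z \<in> verts G" for C e z
    using that unfolding edge_closed_def by blast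
  have mem: "z \<in> ?C x \<and> z \<in> verts G \<or> z \<notin> verts G \<and> (\<exists>e\<in>H. z \<in> e \<and> e \<inter> ?C x \<noteq> {})"
    if z: "z \<in> component_drawing G H x" "edge_closed G H (?C x)" for x z
  proof (cases "z \<in> ?C x")
    case True
    then show ?thesis using z(2) by (auto simp: edge_closed_def)
  next
    case False
    then obtain e where "e \<in> H" "z \<in> e" "e \<inter> ?C x \<noteq> {}"
      using z(1) unfolding component_drawing_def by blast
    then show ?thesis using inC [OF z(2)] by blast
  qed
  show ?thesis
  proof (rule equals0I)
    fix z assume z: "z \<in> component_drawing G H v \<inter> component_drawing G H w"
    show False
    proof (cases "z \<in> verts G")
      case True
      then have "z \<in> ?C v" "z \<in> ?C w"
        using mem [of z v] mem [of z w] z cl by auto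
      then show False using disj by blast
    next
      case False
      then obtain e f where e: "e \<in> H" "z \<in> e" "e \<inter> ?C v \<noteq> {}" and f: "f \<in> H" "z \<in> f" "f \<inter> ?C w \<noteq> {}"
        using mem [of z v] mem [of z w] z cl by auto
      have "e = f"
        using plane_graph_edges_meet [OF G, of e f] H False e f by blast
      obtain c d where cd: "c \<in> e" "c \<in> ?C v" "d \<in> e" "d \<in> ?C w"
        using e f \<open>e = f\<close> by auto
      have "d \<in> ?C v"
        by (rule inC [OF cl(1) cd(3) e(1,3)]) (use cd(4) cl(2) in \<open>auto simp: edge_closed_def\<close>)
      then show False using cd(4) disj by blast
    qed
  qed
qed

text \<open>An odd number of terminals lies strictly between \<open>vs ! i\<close> and \<open>vs ! j\<close>, whereas a union of
  components has an even number, so some component leads from a terminal in between to one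
  outside; it would have to cross the component of \<open>vs ! i\<close> and \<open>vs ! j\<close>.\<close>

lemma no_component_joins_same_parity:
  assumes G: "plane_graph G" and F: "F \<in> faces G" and cyc: "cyclic_order_on_face F vs"
    and dist: "distinct vs" and vsV: "set vs \<subseteq> verts G"
    and m1: "m1 \<in> perfect_matchings (G \<ominus> S1)" and m2: "m2 \<in> perfect_matchings (G \<ominus> S2)"
    and S: "S1 \<inter> S2 = {}" "S1 \<union> S2 = set vs"
    and ij: "i < j" "j < length vs" "even (j - i)"
    and conn: "(vs ! i, vs ! j) \<in> (adj G (m1 \<union> m2))\<^sup>*"
  shows False
proof -
  define H where "H = m1 \<union> m2"
  define R where "R = (adj G H)\<^sup>*"
  have HE: "H \<subseteq> edges G"
    using m1 m2 by (auto simp: H_def perfect_matchings_delete_verts)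
  have Rsym: "(y, x) \<in> R" if "(x, y) \<in> R" for x y
    using that unfolding R_def by (rule adj_rtrancl_sym)
  have Rtrans: "(x, z) \<in> R" if "(x, y) \<in> R" "(y, z) \<in> R" for x y z
    using that unfolding R_def by (rule rtrancl_trans)
  have S1: "S1 \<subseteq> verts G" "S2 \<subseteq> verts G" using S vsV by auto
  have at1: "e \<notin> m1" if "x \<in> S1" "x \<in> e" for x e
    using that S1 perfect_matching_deleteD(2) [OF m1] by blast
  have at2: "e \<notin> m2" if "x \<in> S2" "x \<in> e" for x e
    using that S1 perfect_matching_deleteD(2) [OF m2] by blast
  note un = perfect_matching_edge_unique [OF m1] perfect_matching_edge_unique [OF m2]
  \<comment> \<open>Every vertex meets at most one edge of each matching, and a terminal, being
    deleted for one of them, at most one edge in all.\<close>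
  have two: "p = q" if "x \<in> set vs" "p \<in> set vs" "(x, p) \<in> R" "p \<noteq> x" "q \<in> set vs" "(x, q) \<in> R" "q \<noteq> x"
    for x p q
  proof (rule component_at_most_two_leaves [where T = "set vs" and a = x and G = G and H = H])
    show "e = f" if "y \<in> set vs" "y \<in> verts G" "e \<in> H" "f \<in> H" "y \<in> e" "y \<in> f" for y e f
    proof -
      have "y \<in> S1 \<or> y \<in> S2" using that S by blast
      then have "e \<in> m2 \<and> f \<in> m2 \<or> e \<in> m1 \<and> f \<in> m1"
        using that at1 at2 unfolding H_def by blast
      then show ?thesis using un that by blast
    qed
    show "e = f \<or> e = h \<or> f = h" if "y \<in> verts G" "e \<in> H" "f \<in> H" "h \<in> H" "y \<in> e" "y \<in> f" "y \<in> h"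
      for y e f h
    proof -
      have "e \<in> m1 \<or> e \<in> m2" "f \<in> m1 \<or> f \<in> m2" "h \<in> m1 \<or> h \<in> m2"
        using that by (auto simp: H_def)
      then show ?thesis using un that by metis
    qed
  qed (use that vsV HE plane_graph_edge [OF G] plane_graph_finite [OF G] in \<open>auto simp: R_def\<close>)
  define Mid where "Mid = (!) vs ` {i<..<j}"
  have Mid: "Mid \<subseteq> set vs" using ij by (auto simp: Mid_def)
  have "card Mid = j - i - 1"
    unfolding Mid_def by (subst card_image) (use dist ij in \<open>auto simp: inj_on_def nth_eq_iff_index_eq\<close>)
  then have oddMid: "odd (card Mid)" using ij by auto
  define C where "C = R `` Mid"
  have C: "edge_closed G H C"
    unfolding C_def R_def using Mid vsV by (intro edge_closed_adj_image) auto
  then have finC: "finite C"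
    using plane_graph_finite [OF G] finite_subset unfolding edge_closed_def by blast
  \<comment> \<open>Both \<open>card (C \<inter> S1)\<close> and \<open>card (C \<inter> S2)\<close>
    have the parity of \<open>card C\<close>, so their sum is even.\<close>
  have "even (card (C - S1))" "even (card (C - S2))"
    using even_card_edge_closed [OF G m1] even_card_edge_closed [OF G m2] edge_closed_mono [OF C]
    by (auto simp: H_def)
  moreover have "card C = card (C \<inter> S1) + card (C - S1)" "card C = card (C \<inter> S2) + card (C - S2)"
    using finC by (simp_all add: card_Int_Diff)
  moreover have "card (C \<inter> set vs) = card (C \<inter> S1) + card (C \<inter> S2)"
    unfolding S(2) [symmetric] Int_Un_distrib using finC S(1) by (intro card_Un_disjoint) auto
  ultimately have evenC: "even (card (C \<inter> set vs))" by presburger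
  have "Mid \<subseteq> C" by (auto simp: C_def R_def)
  then have "\<not> C \<inter> set vs \<subseteq> Mid"
    using evenC oddMid Mid by (metis Int_greatest subset_antisym)
  then obtain y where y: "y \<in> C" "y \<in> set vs" "y \<notin> Mid" by blast
  obtain l where l: "i < l" "l < j" "(vs ! l, y) \<in> R"
    using y(1) by (auto simp: C_def Mid_def)
  obtain l' where "l' < length vs" "y = vs ! l'"
    using y(2) by (auto simp: in_set_conv_nth)
  then have l': "l' < length vs" "l' \<notin> {i<..<j}" and ll': "(vs ! l, vs ! l') \<in> R"
    using y l by (auto simp: Mid_def)
  have iR: "(vs ! i, vs ! j) \<in> R" using conn by (simp add: R_def H_def)
  have idx: "vs ! x = vs ! y \<longleftrightarrow> x = y" if "x < length vs" "y < length vs" for x y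
    using dist that nth_eq_iff_index_eq by blast
  \<comment> \<open>The component of \<open>vs ! i\<close> already has \<open>vs ! j\<close> as its
    second terminal.\<close>
  have il: "(vs ! i, vs ! l) \<notin> R"
  proof
    assume "(vs ! i, vs ! l) \<in> R"
    then have "vs ! l = vs ! j"
      using two [of "vs ! i" "vs ! l" "vs ! j"] iR ij l idx by auto
    then show False using idx l ij by auto
  qed
  have "l' \<noteq> i" using il ll' Rsym by blast
  moreover have "l' \<noteq> j" using il ll' Rsym Rtrans iR by blast
  ultimately have l'': "l' < i \<or> j < l'" using l' by auto
  define P where "P = component_drawing G H (vs ! i)"
  define Q where "Q = component_drawing G H (vs ! l)"
  have V: "vs ! i \<in> verts G" "vs ! l \<in> verts G" using vsV ij l by auto
  have ends: "vs ! i \<in> P" "vs ! j \<in> P" "vs ! l \<in> Q" "vs ! l' \<in> Q"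
    using iR ll' by (auto simp: P_def Q_def component_drawing_def R_def)
  have PQ: "compact P" "connected P" "compact Q" "connected Q"
    unfolding P_def Q_def using compact_component_drawing connected_component_drawing G HE V by blast+
  have disj: "P \<inter> Q = {}"
    unfolding P_def Q_def using component_drawings_disjoint [OF G HE V] il by (simp add: R_def)
  have FG: "F \<inter> (verts G \<union> \<Union>(edges G)) = {}"
    using F in_components_subset unfolding faces_def by blast
  obtain g ts where g: "simple_path g" "pathfinish g = pathstart g"
    and io: "inside (path_image g) \<subseteq> F \<or> outside (path_image g) \<subseteq> F"
    and ts: "sorted_wrt (<) ts" "set ts \<subseteq> {0..<1}" "map g ts = vs"
    using cyc unfolding cyclic_order_on_face_def by blast
  obtain I where I: "I = inside (path_image g) \<or> I = outside (path_image g)" "I \<subseteq> F"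
    using io by blast
  have PI: "P \<inter> I = {}" "Q \<inter> I = {}"
    using component_drawing_subset [OF HE V(1)] component_drawing_subset [OF HE V(2)] FG I(2)
    unfolding P_def Q_def by blast+
  have len: "length ts = length vs" using ts by auto
  have gts: "g (ts ! x) = vs ! x" if "x < length vs" for x
    by (metis len nth_map that ts(3))
  have ts01: "0 \<le> ts ! x" "ts ! x < 1" if "x < length vs" for x
  proof -
    have "ts ! x \<in> {0..<1}" using ts(2) that len nth_mem by (metis subsetD)
    then show "0 \<le> ts ! x" "ts ! x < 1" by auto
  qed
  have less: "ts ! x < ts ! y" if "x < y" "y < length vs" for x y
    using ts(1) that len by (simp add: sorted_wrt_iff_nth_less)
  have bounds: "i < length vs" "l < length vs" using ij l by auto
  have "vs ! i = g (ts ! i)" "vs ! j = g (ts ! j)" "vs ! l = g (ts ! l)" "vs ! l' = g (ts ! l')"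
    using gts bounds ij l' by simp_all
  note ends' = ends [unfolded this]
  from l'' show False
  proof
    assume "j < l'"
    show False
      by (rule no_interlaced_continua [OF g I(1) ts01(1) [OF bounds(1)] less less less ts01(2)
            PQ(1,2) PI(1) ends'(1,2) PQ(3,4) PI(2) ends'(3,4) disj])
         (use \<open>j < l'\<close> l l' ij in auto)
  next
    \<comment> \<open>Now the order along the curve is \<open>l'\<close>, \<open>i\<close>,
      \<open>l\<close>, \<open>j\<close>, so \<open>P\<close> and \<open>Q\<close> change
      roles.\<close>
    assume "l' < i"
    show False
      by (rule no_interlaced_continua [OF g I(1) ts01(1) [OF l'(1)] less less less ts01(2)
            PQ(3,4) PI(2) ends'(4,3) PQ(1,2) PI(1) ends'(1,2)])
         (use \<open>l' < i\<close> l l' ij disj in auto)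
  qed
qed

subsection \<open>The exchange involution\<close>

text \<open>List positions count from 0, so the \<open>a\<close> terminals sit at even positions and
  any two of them have an even index difference.\<close>

lemma alternating_concat:
  fixes a b :: "nat \<Rightarrow> 'a" and k :: nat
  shows "length (concat (map (\<lambda>i. [a i, b i]) [1..<Suc k])) = 2 * k \<and>
    set (concat (map (\<lambda>i. [a i, b i]) [1..<Suc k])) = a ` {1..k} \<union> b ` {1..k} \<and>
    (\<forall>l<k. concat (map (\<lambda>i. [a i, b i]) [1..<Suc k]) ! (2 * l) = a (Suc l))"
proof (induction k)
  case 0
  then show ?case by simp
next
  case (Suc k)
  define vs where "vs = concat (map (\<lambda>i. [a i, b i]) [1..<Suc k])"
  have eq: "concat (map (\<lambda>i. [a i, b i]) [1..<Suc (Suc k)]) = vs @ [a (Suc k), b (Suc k)]"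
    unfolding vs_def by (subst upt_Suc_append) auto
  have IH: "length vs = 2 * k" "set vs = a ` {1..k} \<union> b ` {1..k}" "\<And>l. l < k \<Longrightarrow> vs ! (2 * l) = a (Suc l)"
    using Suc.IH by (auto simp: vs_def)
  have "(vs @ [a (Suc k), b (Suc k)]) ! (2 * l) = a (Suc l)" if "l < Suc k" for l
    using that IH by (cases "l = k") (auto simp: nth_append)
  moreover have "{1..Suc k} = insert (Suc k) {1..k}" by auto
  ultimately show ?case
    unfolding eq using IH(1,2) by auto
qed

text \<open>The terms of the left-hand sum are the case \<open>Z = {}\<close>, those of the right-hand sum \<open>Z = A1\<close>.\<close>

definition matching_pairs ::
  "'w plane_wgraph \<Rightarrow> complex set \<Rightarrow> complex set \<Rightarrow> complex set \<Rightarrow> (complex set \<times> complex set set \<times> complex set set) set"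
  where "matching_pairs G A B Z = (SIGMA W:Pow B.
    perfect_matchings (G \<ominus> (Z \<union> W)) \<times> perfect_matchings (G \<ominus> (A - Z \<union> (B - W))))"

text \<open>Multiplying out turns the desired identity into a comparison of two weighted sets of
  pairs.\<close>

lemma sum_M_products_eq:
  assumes "plane_graph G" "finite B"
  shows "(\<Sum>W\<in>Pow B. M (G \<ominus> (Z \<union> W)) * M (G \<ominus> (A - Z \<union> (B - W)))) =
    (\<Sum>(W, m, m')\<in>matching_pairs G A B Z. prod (weight G) m * prod (weight G) m')"
  unfolding M_delete_verts sum_product matching_pairs_def sum.cartesian_product
  by (subst sum.Sigma) (use assms finite_perfect_matchings in auto)

text \<open>Exchanging the two matchings along the components that meet \<open>A1\<close> toggles membership in the
  deleted set exactly for the terminals on those components.\<close>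

lemma exchange_matching_pairs:
  assumes "A \<inter> B = {}" and pair: "(W, m, m') \<in> matching_pairs G A B Z" and "Z \<subseteq> A" "A1 \<subseteq> A"
    and C: "edge_closed G (m \<union> m') C" and CA: "C \<inter> A = A1"
  shows "(W - C \<union> (B - W) \<inter> C, exchange C m m', exchange C m' m) \<in> matching_pairs G A B (Z - A1 \<union> (A1 - Z))"
proof -
  have W: "W \<subseteq> B" and m: "m \<in> perfect_matchings (G \<ominus> (Z \<union> W))"
    and m': "m' \<in> perfect_matchings (G \<ominus> (A - Z \<union> (B - W)))"
    using pair by (auto simp: matching_pairs_def)
  have C': "edge_closed G (m' \<union> m) C" using C by (simp add: Un_commute)
  have "Z \<union> W - C \<union> (A - Z \<union> (B - W)) \<inter> C = (Z - A1 \<union> (A1 - Z)) \<union> (W - C \<union> (B - W) \<inter> C)"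
    using assms(1,3,4) CA W by auto
  moreover have "A - Z \<union> (B - W) - C \<union> (Z \<union> W) \<inter> C =
      A - (Z - A1 \<union> (A1 - Z)) \<union> (B - (W - C \<union> (B - W) \<inter> C))"
    using assms(1,3,4) CA W by auto
  ultimately show ?thesis
    using exchange_perfect_matching [OF m m' C] exchange_perfect_matching [OF m' m C'] W
    by (auto simp: matching_pairs_def)
qed

theorem theorem2p6:
  fixes G :: "'w::comm_ring_1 plane_wgraph"
    and a b :: "nat \<Rightarrow> complex"
    and A B A1 A2 F :: "complex set"
    and n k :: nat
  assumes "plane_graph G"
    and "card (verts G) = 2 * n + 1"
    and "2 \<le> k" and "k \<le> n"
    and "A = a ` {1..k}" and "B = b ` {1..k}"
    and "A \<subseteq> verts G" and "B \<subseteq> verts G"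
    and "inj_on a {1..k}" and "inj_on b {1..k}" and "A \<inter> B = {}"
    and "F \<in> faces G"
    and "cyclic_order_on_face F (concat (map (\<lambda>i. [a i, b i]) [1..<Suc k]))"
    and "A1 \<union> A2 = A" and "A1 \<inter> A2 = {}"
  shows "(\<Sum>W | W \<subseteq> B \<and> odd (card W). M (G \<ominus> W) * M (G \<ominus> (A \<union> (B - W)))) =
         (\<Sum>Y | Y \<subseteq> B \<and> odd (int (card Y) - int (card A1)).
            M (G \<ominus> (A1 \<union> Y)) * M (G \<ominus> (A2 \<union> (B - Y))))"
proof -
  note G = assms(1)
  define vs where "vs = concat (map (\<lambda>i. [a i, b i]) [1..<Suc k])"
  have vs: "length vs = 2 * k" "set vs = A \<union> B" "\<And>l. l < k \<Longrightarrow> vs ! (2 * l) = a (Suc l)"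
    using alternating_concat [of a b k] unfolding vs_def assms(5,6) by auto
  have finA: "finite A" "finite B" using assms(5,6) by auto
  have "card (A \<union> B) = 2 * k"
    using assms(5,6,9-11) finA by (simp add: card_Un_disjoint card_image)
  then have dist: "distinct vs" using vs by (simp add: card_distinct)
  have A1: "A1 \<subseteq> A" and A2: "A2 = A - A1" using assms(14,15) by auto
  have idx: "\<exists>l. x = vs ! (2 * l) \<and> 2 * l < length vs" if "x \<in> A" for x
  proof -
    obtain i where "i \<in> {1..k}" "x = a i" using \<open>x \<in> A\<close> assms(5) by auto
    then show ?thesis using vs by (intro exI [of _ "i - 1"]) auto
  qed
  have separate: "x = y"
    if pair: "(W, m, m') \<in> matching_pairs G A B Z" and Z: "Z \<subseteq> A" and xy: "x \<in> A" "y \<in> A"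
      and conn: "(x, y) \<in> (adj G (m \<union> m'))\<^sup>*" for W m m' Z x y
  proof -
    obtain i j where i: "x = vs ! (2 * i)" "2 * i < length vs" and j: "y = vs ! (2 * j)" "2 * j < length vs"
      using idx xy by blast
    have m: "W \<subseteq> B" "m \<in> perfect_matchings (G \<ominus> (Z \<union> W))" "m' \<in> perfect_matchings (G \<ominus> (A - Z \<union> (B - W)))"
      using pair by (auto simp: matching_pairs_def)
    have S: "(Z \<union> W) \<inter> (A - Z \<union> (B - W)) = {}" "Z \<union> W \<union> (A - Z \<union> (B - W)) = set vs"
      using Z m(1) assms(11) vs(2) by auto
    have sub: "set vs \<subseteq> verts G" using vs(2) assms(7,8) by auto
    note no = no_component_joins_same_parity
      [OF G assms(12) assms(13) [folded vs_def] dist sub m(2,3) S]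
    show ?thesis
    proof (rule linorder_cases [of i j])
      assume "i < j"
      then show ?thesis using no [of "2 * i" "2 * j"] i j conn by (simp add: diff_mult_distrib2 [symmetric])
    next
      assume "j < i"
      then show ?thesis using no [of "2 * j" "2 * i"] i j adj_rtrancl_sym [OF conn]
        by (simp add: diff_mult_distrib2 [symmetric])
    qed (use i j in simp)
  qed
  define C where "C m m' = (adj G (m \<union> m'))\<^sup>* `` A1" for m m'
  have closed: "edge_closed G (m \<union> m') (C m m')" for m m'
    unfolding C_def using A1 assms(7) by (intro edge_closed_adj_image) auto
  \<comment> \<open>By \<open>separate\<close>, a component meeting \<open>A1\<close> contains no
    second element of \<open>A\<close>.\<close>
  have CA: "C m m' \<inter> A = A1" if "(W, m, m') \<in> matching_pairs G A B Z" "Z \<subseteq> A" for W m m' Z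
  proof
    show "A1 \<subseteq> C m m' \<inter> A" using A1 by (auto simp: C_def)
    show "C m m' \<inter> A \<subseteq> A1" using separate [OF that] A1 by (auto simp: C_def)
  qed
  \<comment> \<open>Inside \<open>C m m'\<close> the matchings change places, so there
    \<open>W\<close> is replaced by its complement in \<open>B\<close>.\<close>
  define swap where "swap = (\<lambda>(W, m, m').
    (W - C m m' \<union> (B - W) \<inter> C m m', exchange (C m m') m m', exchange (C m m') m' m))"
  have swap_in: "swap p \<in> matching_pairs G A B (Z - A1 \<union> (A1 - Z))"
    if "p \<in> matching_pairs G A B Z" "Z \<subseteq> A" for p Z
  proof -
    obtain W m m' where p: "p = (W, m, m')" by (cases p)
    show ?thesis
      using exchange_matching_pairs [OF assms(11) _ that(2) A1 closed CA [OF _ that(2)]] that(1)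
      unfolding p swap_def by simp
  qed
  have swap_swap: "swap (swap p) = p" if "p \<in> matching_pairs G A B Z" for p Z
  proof -
    obtain W m m' where p: "p = (W, m, m')" by (cases p)
    have "W \<subseteq> B" using that by (simp add: p matching_pairs_def)
    \<comment> \<open>The exchange preserves the superposition \<open>m \<union> m'\<close>, hence
      the set on which it acts; so \<open>swap\<close> undoes itself.\<close>
    moreover have "C (exchange (C m m') m m') (exchange (C m m') m' m) = C m m'"
      by (simp add: C_def exchange_Un)
    ultimately show ?thesis
      by (auto simp: p swap_def exchange_exchange)
  qed
  define w where "w = (\<lambda>(W :: complex set, m, m'). prod (weight G) m * prod (weight G) m')"
  have w_swap: "w (swap p) = w p" if "p \<in> matching_pairs G A B Z" for p Z
  proof -
    obtain W m m' where p: "p = (W, m, m')" by (cases p)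
    have "m \<subseteq> edges G" "m' \<subseteq> edges G"
      using that perfect_matching_deleteD(1) by (auto simp: p matching_pairs_def)
    then have "finite m" "finite m'" using plane_graph_finite [OF G] finite_subset by auto
    then show ?thesis by (simp add: p swap_def w_def prod_exchange)
  qed
  \<comment> \<open>Symmetric difference with \<open>A1\<close> takes \<open>{}\<close> to
    \<open>A1\<close> and \<open>A1\<close> to \<open>{}\<close>.\<close>
  have bij: "sum w (matching_pairs G A B {}) = sum w (matching_pairs G A B A1)"
  proof (rule sum.reindex_bij_witness [of _ swap swap])
    show "swap p \<in> matching_pairs G A B A1" if "p \<in> matching_pairs G A B {}" for p
      using swap_in [OF that] by simp
    show "swap p \<in> matching_pairs G A B {}" if "p \<in> matching_pairs G A B A1" for p
      using swap_in [OF that A1] by simp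
  qed (use swap_swap w_swap in auto)
  have fin: "finite (verts G)" using plane_graph_finite [OF G] by simp
  \<comment> \<open>Deleting an even number of the \<open>2 * n + 1\<close> vertices leaves an odd
    number.\<close>
  have vanish: "M (G \<ominus> (Z \<union> W)) = 0" if "Z \<subseteq> A" "W \<subseteq> B" "even (card Z + card W)" for Z W
  proof (rule M_eq_0_if_odd [OF G])
    have "card (Z \<union> W) = card Z + card W"
      using that finA assms(11) by (intro card_Un_disjoint) (auto intro: finite_subset)
    moreover have "Z \<union> W \<subseteq> verts G" using that assms(7,8) by auto
    then have "card (verts G - (Z \<union> W)) + card (Z \<union> W) = 2 * n + 1"
      using fin assms(2) card_Diff_subset card_mono
      by (metis finite_subset le_add_diff_inverse2)
    ultimately show "odd (card (verts G - (Z \<union> W)))"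
      using that(3) by presburger
  qed
  \<comment> \<open>Passing to all \<open>W \<subseteq> B\<close> adds only terms whose first factor
    vanishes.\<close>
  have full: "(\<Sum>W | W \<subseteq> B \<and> odd (card Z + card W). M (G \<ominus> (Z \<union> W)) * M (G \<ominus> (A - Z \<union> (B - W)))) =
      sum w (matching_pairs G A B Z)" if "Z \<subseteq> A" for Z
    unfolding w_def sum_M_products_eq [OF G finA(2), symmetric]
    by (rule sum.mono_neutral_left) (use finA vanish [OF that] in auto)
  have parity: "odd (int (card Y) - int (card A1)) \<longleftrightarrow> odd (card A1 + card Y)" for Y :: "complex set"
    by presburger
  show ?thesis
    unfolding A2 parity using full [of "{}"] full [OF A1] bij by simp
qed

end
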